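(* Let $\vec{X}=(X_1,\ldots,X_n)$ be $n$ commuting endomorphisms of a finite-dimensional complex vector space $E$, and let $\vec\lambda\in\mathbb{C}^n$. Consider a splitting $E=E_1\oplus E_2$, and denote by $i_j:E_j\to E$ the injection of $E_j$ into $E$ and by $p_j:E\to E_j$ the projection of $E$ onto $E_j$. If $E_1$ is stable under the action of the operators $X_\ell$, i.e. $p_2X_\ell i_1=0$ for all $\ell$, and if $\vec\lambda$ is not in the joint spectrum $\sigma(\vec{X}_2)$ of the commuting operators $X_{\ell2}=p_2X_\ell i_2\in\operatorname{End}_{\mathbb{C}}(E_2)$, then any cocycle $C\in E\otimes\bigwedge$ of the Koszul complex $K^*(\vec{X}_\lambda,E)$, where $\vec{X}_\lambda=(X_1-\lambda_1\operatorname{id}_E,\ldots,X_n-\lambda_n\operatorname{id}_E)$, is cohomologous to a cocycle $C_1\in E_1\otimes\bigwedge$, with $\bigwedge=\bigwedge_n\langle\vec\eta\rangle$.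
   Context: $\bigwedge_n\langle\vec\eta\rangle$ is the complex Grassmann algebra on generators $\eta_1,\ldots,\eta_n$, and $e_{\eta_k}$ is left multiplication by $\eta_k$. For commuting operators $\vec{Z}=(Z_1,\ldots,Z_n)$ on $E$, the Koszul cochain complex $K^*(\vec{Z},E)$ is $0\to E\to E\otimes\bigwedge^1\to\cdots\to E\otimes\bigwedge^n\to0$ with differential $\mathcal{K}_{\vec Z}=\sum_kZ_k\otimes e_{\eta_k}$. The joint spectrum $\sigma(\vec{Z})$ of commuting operators on a finite-dimensional complex vector space is the set of $\vec\lambda\in\mathbb{C}^n$ for which there is a nonzero vector $v$ with $Z_jv=\lambda_jv$ for all $j$; equivalently, for which there do not exist $W_j$ in the unital subalgebra generated by $\vec{Z}$ with $\sum_jW_j(Z_j-\lambda_j\operatorname{id})=\operatorname{id}$. *)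

theory Defs
  imports Complex_Main
begin

section \<open>The Grassmann algebra\<close>

text \<open>
  An element of the complex Grassmann algebra on generators \<open>\<eta>\<^sub>1, \<dots>, \<eta>\<^sub>n\<close> is represented by its
  coefficients: \<open>a :: nat set \<Rightarrow> complex\<close> stands for the sum of all \<open>a I \<eta>\<^sub>I\<close>, where
  \<open>\<eta>\<^sub>I = \<eta>\<^sub>i\<^sub>1 \<cdots> \<eta>\<^sub>i\<^sub>p\<close> for \<open>I = {i\<^sub>1 < \<dots> < i\<^sub>p} \<subseteq> {1..n}\<close>. The product is determined by
  \<open>\<eta>\<^sub>I \<eta>\<^sub>L = \<plusminus> \<eta>\<^sub>I\<^sub>\<union>\<^sub>L\<close> for disjoint \<open>I\<close> and \<open>L\<close>, the sign being that of the permutation sorting the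
  concatenation, and by \<open>\<eta>\<^sub>I \<eta>\<^sub>L = 0\<close> otherwise.
\<close>

definition grassmann :: "nat \<Rightarrow> (nat set \<Rightarrow> complex) set" where
  "grassmann n = {a. \<forall>I. \<not> I \<subseteq> {1..n} \<longrightarrow> a I = 0}"

definition shuffle_sign :: "nat set \<Rightarrow> nat set \<Rightarrow> complex" where
  "shuffle_sign I L = (- 1) ^ card {(i, l). i \<in> I \<and> l \<in> L \<and> l < i}"

definition grassmann_mult ::
    "(nat set \<Rightarrow> complex) \<Rightarrow> (nat set \<Rightarrow> complex) \<Rightarrow> nat set \<Rightarrow> complex" where
  "grassmann_mult a b J = (\<Sum>I\<in>Pow J. shuffle_sign I (J - I) * a I * b (J - I))"

definition monomial :: "nat set \<Rightarrow> nat set \<Rightarrow> complex" where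
  "monomial I J = (if J = I then 1 else 0)"

definition gen :: "nat \<Rightarrow> nat set \<Rightarrow> complex" where
  "gen k = monomial {k}"

lemma grassmann_mult_gen_left:
  assumes "finite J"
  shows "grassmann_mult (gen k) b J
    = (if k \<in> J then (- 1) ^ card {i \<in> J. i < k} * b (J - {k}) else 0)"
proof -
  have "grassmann_mult (gen k) b J
      = (\<Sum>I\<in>Pow J. if I = {k} then shuffle_sign {k} (J - {k}) * b (J - {k}) else 0)"
    unfolding grassmann_mult_def gen_def monomial_def by (rule sum.cong) auto
  also have "\<dots> = (if k \<in> J then shuffle_sign {k} (J - {k}) * b (J - {k}) else 0)"
    using assms by (simp add: sum.delta')
  also have "card {(i, l). i \<in> {k} \<and> l \<in> J - {k} \<and> l < i} = card {i \<in> J. i < k}"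
    by (rule bij_betw_same_card[where f = snd]) (auto simp: bij_betw_def inj_on_def image_iff)
  then have "shuffle_sign {k} (J - {k}) = (- 1) ^ card {i \<in> J. i < k}"
    by (simp add: shuffle_sign_def)
  finally show ?thesis by simp
qed

lemma gen_mult_monomial:
  assumes "finite I" "k \<notin> I" "\<And>i. i \<in> I \<Longrightarrow> k < i"
  shows "grassmann_mult (gen k) (monomial I) = monomial (insert k I)"
proof
  fix J
  show "grassmann_mult (gen k) (monomial I) J = monomial (insert k I) J"
  proof (cases "finite J")
    case True
    show ?thesis
    proof (cases "J = insert k I")
      case J: True
      have "{i \<in> J. i < k} = {}" "J - {k} = I" using J assms(2,3) by (auto dest: less_asym)
      then show ?thesis using True J by (simp only: grassmann_mult_gen_left) (simp add: monomial_def)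
    next
      case J: False
      then have "k \<in> J \<Longrightarrow> J - {k} \<noteq> I" by auto
      then show ?thesis using True J by (simp add: grassmann_mult_gen_left monomial_def)
    qed
  next
    case False
    then show ?thesis using assms(1) by (auto simp: grassmann_mult_def monomial_def)
  qed
qed

lemma gen_anticommute:
  "grassmann_mult (gen k) (gen l) J = - grassmann_mult (gen l) (gen k) J"
proof (cases "finite J")
  case True
  have *: "J - {k} = {l} \<and> k \<in> J \<longleftrightarrow> J = {k, l} \<and> k \<noteq> l" for k l by auto
  have c: "{i. (i = k \<or> i = l) \<and> i < k} = (if l < k then {l} else {})" for k l :: nat by auto
  have "grassmann_mult (gen k) (gen l) J
      = (if J = {k, l} \<and> k \<noteq> l then (if l < k then - 1 else 1) else 0)" for k l
    using True *[of k l] c[of k l] by (auto simp: grassmann_mult_gen_left gen_def[of l] monomial_def)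
  then show ?thesis by (auto simp: insert_commute)
next
  case False
  then show ?thesis by (simp add: grassmann_mult_def)
qed


section \<open>Tensoring with the Grassmann algebra\<close>

text \<open>
  Since the \<open>\<eta>\<^sub>I\<close> form a basis of the Grassmann algebra, an element of its tensor product with a
  vector space is written uniquely as the sum of all \<open>C I \<otimes> \<eta>\<^sub>I\<close>, and is represented by the
  family \<open>C\<close>.
\<close>

definition tensor_grassmann :: "nat \<Rightarrow> 'a::ab_group_add set \<Rightarrow> (nat set \<Rightarrow> 'a) set" where
  "tensor_grassmann n V = {C. (\<forall>I. I \<subseteq> {1..n} \<longrightarrow> C I \<in> V) \<and> (\<forall>I. \<not> I \<subseteq> {1..n} \<longrightarrow> C I = 0)}"

definition pure_tensor ::
    "(complex \<Rightarrow> 'a \<Rightarrow> 'a) \<Rightarrow> 'a::ab_group_add \<Rightarrow> (nat set \<Rightarrow> complex) \<Rightarrow> nat set \<Rightarrow> 'a" where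
  "pure_tensor scale v a = (\<lambda>J. scale (a J) v)"

text \<open>
  The operator \<open>T \<otimes> A\<close>, expressed through the matrix entries \<open>A \<eta>\<^sub>I J\<close> of \<open>A\<close>; the action on pure
  tensors is verified below for the operators \<open>A\<close> of left multiplication.
\<close>

definition tensor_op ::
    "(complex \<Rightarrow> 'a \<Rightarrow> 'a) \<Rightarrow> nat \<Rightarrow> ('a \<Rightarrow> 'a) \<Rightarrow> ((nat set \<Rightarrow> complex) \<Rightarrow> nat set \<Rightarrow> complex) \<Rightarrow>
      (nat set \<Rightarrow> 'a::ab_group_add) \<Rightarrow> nat set \<Rightarrow> 'a" where
  "tensor_op scale n T A C = (\<lambda>J. \<Sum>I\<in>Pow {1..n}. scale (A (monomial I) J) (T (C I)))"

lemma tensor_op_pure_tensor: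
  assumes "vector_space scale" "Vector_Spaces.linear scale scale T" "a \<in> grassmann n"
  shows "tensor_op scale n T (grassmann_mult g) (pure_tensor scale v a)
    = pure_tensor scale (T v) (grassmann_mult g a)"
proof
  fix J
  interpret vector_space scale by fact
  have T: "T (scale c v) = scale c (T v)" for c v
    using assms(2) by (simp add: Vector_Spaces.linear_def module_hom.scale)
  have "(\<Sum>I\<in>Pow {1..n}. grassmann_mult g (monomial I) J * a I) = grassmann_mult g a J"
  proof -
    have "(\<Sum>I\<in>Pow {1..n}. grassmann_mult g (monomial I) J * a I)
        = (\<Sum>L\<in>Pow J. \<Sum>I\<in>Pow {1..n}. shuffle_sign L (J - L) * g L * (monomial I (J - L) * a I))"
      unfolding grassmann_mult_def sum_distrib_right by (subst sum.swap) (simp add: mult.assoc)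
    also have "\<dots> = (\<Sum>L\<in>Pow J. shuffle_sign L (J - L) * g L * a (J - L))"
    proof (rule sum.cong)
      fix L
      have "(\<Sum>I\<in>Pow {1..n}. monomial I (J - L) * a I)
          = (\<Sum>I\<in>Pow {1..n}. if I = J - L then a (J - L) else 0)"
        by (rule sum.cong) (auto simp: monomial_def)
      also have "\<dots> = a (J - L)"
        using assms(3) by (auto simp: grassmann_def)
      finally show "(\<Sum>I\<in>Pow {1..n}. shuffle_sign L (J - L) * g L * (monomial I (J - L) * a I))
          = shuffle_sign L (J - L) * g L * a (J - L)"
        by (simp flip: sum_distrib_left)
    qed simp
    finally show ?thesis by (simp add: grassmann_mult_def)
  qed
  then show "tensor_op scale n T (grassmann_mult g) (pure_tensor scale v a) J
      = pure_tensor scale (T v) (grassmann_mult g a) J"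
    by (simp add: tensor_op_def pure_tensor_def T flip: scale_sum_left)
qed


section \<open>The Koszul complex\<close>

definition koszul_diff ::
    "(complex \<Rightarrow> 'a \<Rightarrow> 'a) \<Rightarrow> nat \<Rightarrow> (nat \<Rightarrow> 'a \<Rightarrow> 'a) \<Rightarrow> (nat set \<Rightarrow> 'a::ab_group_add) \<Rightarrow> nat set \<Rightarrow> 'a" where
  "koszul_diff scale n Z C = (\<lambda>J. \<Sum>k = 1..n. tensor_op scale n (Z k) (grassmann_mult (gen k)) C J)"

text \<open>
  Cochains are not required to be homogeneous, so cocycles and coboundaries are taken in the direct
  sum of all degrees. Since the differential is homogeneous of degree one, the cohomology of
  this total complex is the direct sum of the cohomologies in the individual degrees.
\<close>

definition cocycle ::
    "(complex \<Rightarrow> 'a \<Rightarrow> 'a) \<Rightarrow> nat \<Rightarrow> (nat \<Rightarrow> 'a \<Rightarrow> 'a) \<Rightarrow> 'a::ab_group_add set \<Rightarrow> (nat set \<Rightarrow> 'a) \<Rightarrow> bool" where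
  "cocycle scale n Z V C \<longleftrightarrow> C \<in> tensor_grassmann n V \<and> koszul_diff scale n Z C = (\<lambda>J. 0)"

definition cohomologous ::
    "(complex \<Rightarrow> 'a \<Rightarrow> 'a) \<Rightarrow> nat \<Rightarrow> (nat \<Rightarrow> 'a \<Rightarrow> 'a) \<Rightarrow> 'a::ab_group_add set \<Rightarrow>
      (nat set \<Rightarrow> 'a) \<Rightarrow> (nat set \<Rightarrow> 'a) \<Rightarrow> bool" where
  "cohomologous scale n Z V C C' \<longleftrightarrow>
    (\<exists>B \<in> tensor_grassmann n V. (\<lambda>J. C J - C' J) = koszul_diff scale n Z B)"


section \<open>Joint spectrum and splittings\<close>

text \<open>
  A point of \<open>\<complex>\<^sup>n\<close> is a function on \<open>nat\<close>, of which only the values on \<open>{1..n}\<close> matter.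
\<close>

definition joint_spectrum ::
    "(complex \<Rightarrow> 'a \<Rightarrow> 'a) \<Rightarrow> nat \<Rightarrow> 'a::ab_group_add set \<Rightarrow> (nat \<Rightarrow> 'a \<Rightarrow> 'a) \<Rightarrow> (nat \<Rightarrow> complex) set" where
  "joint_spectrum scale n V Z =
    {lam. \<exists>v\<in>V. v \<noteq> 0 \<and> (\<forall>j\<in>{1..n}. Z j v = scale (lam j) v)}"

definition splitting ::
    "(complex \<Rightarrow> 'a \<Rightarrow> 'a) \<Rightarrow> 'a::ab_group_add set \<Rightarrow> 'a set \<Rightarrow> bool" where
  "splitting scale V W \<longleftrightarrow> module.subspace scale V \<and> module.subspace scale W \<and>
    V \<inter> W = {0} \<and> {v + w |v w. v \<in> V \<and> w \<in> W} = UNIV"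

text \<open>
  The projection onto \<open>V\<close> along \<open>W\<close>. The summands being subsets of the ambient space, the
  injections are identities.
\<close>

definition proj_along :: "'a::ab_group_add set \<Rightarrow> 'a set \<Rightarrow> 'a \<Rightarrow> 'a" where
  "proj_along V W x = (THE v. v \<in> V \<and> x - v \<in> W)"

lemma proj_along:
  assumes "vector_space scale" "splitting scale V W"
  shows "proj_along V W x \<in> V" "x - proj_along V W x \<in> W"
proof -
  interpret vector_space scale by fact
  have V: "subspace V" and W: "subspace W" and VW: "V \<inter> W = {0}"
    using assms(2) by (auto simp: splitting_def)
  have "x \<in> {v + w |v w. v \<in> V \<and> w \<in> W}"
    using assms(2) by (simp add: splitting_def)
  then obtain v w where v: "v \<in> V" "w \<in> W" "x = v + w" by blast
  have "\<exists>!v. v \<in> V \<and> x - v \<in> W"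
  proof (rule ex1I[of _ v])
    show "v \<in> V \<and> x - v \<in> W" using v by simp
    fix u assume u: "u \<in> V \<and> x - u \<in> W"
    have "u - v \<in> V" using subspace_diff[OF V] u v by blast
    moreover have "u - v \<in> W" using subspace_diff[OF W v(2), of "x - u"] u v(3) by simp
    ultimately have "u - v \<in> V \<inter> W" by blast
    then show "u = v" using VW by simp
  qed
  then have "proj_along V W x \<in> V \<and> x - proj_along V W x \<in> W"
    unfolding proj_along_def by (rule theI')
  then show "proj_along V W x \<in> V" "x - proj_along V W x \<in> W" by auto
qed

end

theory Submission
  imports Defs
begin

text \<open>
  Put \<open>Z\<^sub>j = X\<^sub>j - \<lambda>\<^sub>j\<close>. By Fitting's lemma the projector onto the generalized kernel of \<open>Z\<^sub>j\<close> has the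
  form \<open>1 - W Z\<^sub>j\<close> with \<open>W\<close> in the bicommutant of \<open>Z\<^sub>j\<close>; the product of these projectors is an operator
  \<open>N = 1 - \<Sum>\<^sub>j W\<^sub>j Z\<^sub>j\<close> onto the joint generalized kernel, with all \<open>W\<^sub>j\<close> commuting with all \<open>Z\<^sub>k\<close>.
  The joint generalized kernel lies in \<open>E\<^sub>1\<close>, since a vector of it outside \<open>E\<^sub>1\<close> would produce a
  joint eigenvector in \<open>E/E\<^sub>1 \<cong> E\<^sub>2\<close>. Contraction with the \<open>W\<^sub>j\<close> is a homotopy between \<open>N\<close> and
  the identity of the Koszul complex, so that \<open>C\<close> is cohomologous to \<open>N C\<close>.
\<close>

section \<open>The joint generalized kernel\<close>

context vector_space
begin

lemma linear_funpow:
  assumes "Vector_Spaces.linear scale scale T"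
  shows "Vector_Spaces.linear scale scale (T ^^ k)"
proof (induction k)
  case (Suc k)
  then show ?case using assms by (simp add: Vector_Spaces.linear_iff)
qed (simp add: Vector_Spaces.linear_iff vector_space_axioms)

lemma subspace_range:
  assumes "Vector_Spaces.linear scale scale T"
  shows "subspace (range T)"
  using module_hom.subspace_image[OF assms[unfolded linear_iff_module_hom], of UNIV]
  by (simp add: subspace_UNIV)

lemma subspace_kernel:
  assumes "Vector_Spaces.linear scale scale T"
  shows "subspace {x. T x = 0}"
  using module_hom.subspace_kernel[OF assms[unfolded linear_iff_module_hom]] .

end

lemma range_funpow_antimono:
  fixes T :: "'a \<Rightarrow> 'a"
  assumes "i \<le> j"
  shows "range (T ^^ j) \<subseteq> range (T ^^ i)"
proof -
  obtain d where "j = i + d" using assms le_iff_add by blast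
  then show ?thesis by (simp add: funpow_add image_subset_iff)
qed

lemma funpow_commute:
  assumes "\<And>x. S (T x) = T (S x)"
  shows "S ((T ^^ k) x) = (T ^^ k) (S x)"
  by (induction k) (simp_all add: assms)

section \<open>Fitting's lemma for one operator and for a commuting family\<close>

context finite_dimensional_vector_space
begin

lemma funpow_range_kernel_stabilize:
  assumes T: "Vector_Spaces.linear scale scale T"
  obtains m where "\<And>k. m \<le> k \<Longrightarrow> range (T ^^ k) = range (T ^^ m)"
    and "\<And>k. m \<le> k \<Longrightarrow> {x. (T ^^ k) x = 0} = {x. (T ^^ m) x = 0}"
proof -
  define K where "K k = {x. (T ^^ k) x = 0}" for k
  \<comment> \<open>Rank and codimension of the kernel of \<open>T ^^ k\<close> both decrease weakly
    in \<open>k\<close>. At a minimum of their sum neither can drop any further, so a single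
    \<open>m\<close> serves for ranges and kernels alike.\<close>
  define f where "f k = dim (range (T ^^ k)) + (dimension - dim (K k))" for k
  obtain m where m: "\<And>k. f m \<le> f k"
    using ex_has_least_nat[of "\<lambda>_. True" 0 f] by auto
  note lin = linear_funpow[OF T]
  have T0: "(T ^^ k) 0 = 0" for k
    using lin[of k] by (simp add: module_hom.zero linear_iff_module_hom)
  have stab: "range (T ^^ k) = range (T ^^ m) \<and> K k = K m" if "m \<le> k" for k
  proof -
    have R: "range (T ^^ k) \<subseteq> range (T ^^ m)" by (rule range_funpow_antimono) fact
    have KK: "K m \<subseteq> K k"
    proof
      fix x assume "x \<in> K m"
      moreover obtain d where "k = d + m" using \<open>m \<le> k\<close> by (metis le_Suc_ex add.commute)
      ultimately show "x \<in> K k" by (simp add: K_def funpow_add T0)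
    qed
    have "dim (range (T ^^ k)) \<le> dim (range (T ^^ m))" by (rule dim_subset[OF R])
    moreover have "dim (K m) \<le> dim (K k)" by (rule dim_subset[OF KK])
    moreover have "dim (K k) \<le> dimension" by (rule dim_subset_UNIV)
    ultimately have "dim (range (T ^^ m)) \<le> dim (range (T ^^ k))" "dim (K k) \<le> dim (K m)"
      using m[of k] unfolding f_def by linarith+
    moreover have "subspace (K k)" for k unfolding K_def by (rule subspace_kernel[OF lin])
    ultimately show ?thesis
      using subspace_dim_equal[OF subspace_range[OF lin] subspace_range[OF lin] R]
        subspace_dim_equal[OF _ _ KK] by auto
  qed
  then show thesis using that[of m] unfolding K_def by blast
qed

text \<open>The operator \<open>W\<close> is the Drazin inverse of \<open>T\<close>.\<close>

lemma fitting_inverse: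
  assumes T: "Vector_Spaces.linear scale scale T"
  obtains W m where "Vector_Spaces.linear scale scale W"
    and "\<And>S x. Vector_Spaces.linear scale scale S \<Longrightarrow> (\<And>y. S (T y) = T (S y)) \<Longrightarrow> S (W x) = W (S x)"
    and "\<And>x. (T ^^ m) (x - T (W x)) = 0"
proof -
  obtain m where R: "\<And>k. m \<le> k \<Longrightarrow> range (T ^^ k) = range (T ^^ m)"
    and K: "\<And>k. m \<le> k \<Longrightarrow> {x. (T ^^ k) x = 0} = {x. (T ^^ m) x = 0}"
    using funpow_range_kernel_stabilize[OF T] by blast
  note lin = linear_funpow[OF T]
  have sub: "subspace (range (T ^^ m))" by (rule subspace_range[OF lin])
  have diff: "(T ^^ k) (x - y) = (T ^^ k) x - (T ^^ k) y" for k x y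
    using lin[of k] by (simp add: module_hom.diff linear_iff_module_hom)
  \<comment> \<open>\<open>T ^^ Suc m\<close> is injective on \<open>range (T ^^ m)\<close>, because
    the kernels no longer grow after \<open>m\<close>.\<close>
  have uniq: "y = y'"
    if "y \<in> range (T ^^ m)" "y' \<in> range (T ^^ m)" "(T ^^ Suc m) y = (T ^^ Suc m) y'" for y y'
  proof -
    have "y - y' \<in> range (T ^^ m)" by (rule subspace_diff[OF sub that(1,2)])
    then obtain z where z: "y - y' = (T ^^ m) z" by blast
    have "(T ^^ (Suc m + m)) z = (T ^^ Suc m) (y - y')" by (simp only: z funpow_add comp_def)
    also have "\<dots> = 0" by (simp only: diff that(3)) simp
    finally have "(T ^^ m) z = 0" using K[of "Suc m + m"] by auto
    then show ?thesis using z by simp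
  qed
  \<comment> \<open>Existence comes from the stable ranges: write \<open>(T ^^ m) x\<close> as
    \<open>(T ^^ (Suc m + m)) z\<close> and take \<open>y = (T ^^ m) z\<close>.\<close>
  have ex: "\<exists>y. y \<in> range (T ^^ m) \<and> (T ^^ Suc m) y = (T ^^ m) x" for x
  proof -
    have "(T ^^ m) x \<in> range (T ^^ (Suc m + m))" using R[of "Suc m + m"] by simp
    then obtain z where "(T ^^ m) x = (T ^^ (Suc m + m)) z" by blast
    then show ?thesis by (intro exI[of _ "(T ^^ m) z"]) (simp add: funpow_add)
  qed
  \<comment> \<open>By \<open>uniq\<close> the choice is canonical. Hence \<open>W\<close> inherits
    linearity, and every linear \<open>S\<close> commuting with \<open>T\<close> also commutes with
    \<open>W\<close>.\<close>
  define W where "W x = (SOME y. y \<in> range (T ^^ m) \<and> (T ^^ Suc m) y = (T ^^ m) x)" for x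
  have W: "W x \<in> range (T ^^ m)" "(T ^^ Suc m) (W x) = (T ^^ m) x" for x
    using someI_ex[OF ex[of x]] unfolding W_def by auto
  have addk: "(T ^^ k) (x + y) = (T ^^ k) x + (T ^^ k) y"
    and sck: "(T ^^ k) (scale c x) = scale c ((T ^^ k) x)" for k x y c
    using lin[of k] by (simp_all add: Vector_Spaces.linear_iff)
  have "Vector_Spaces.linear scale scale W"
    unfolding Vector_Spaces.linear_iff
  proof (intro conjI allI vector_space_axioms)
    show "W (x + y) = W x + W y" for x y
      by (rule uniq) (use W sub in \<open>simp_all only: addk subspace_add\<close>)
    show "W (scale c x) = scale c (W x)" for c x
      by (rule uniq) (use W sub in \<open>simp_all only: sck subspace_scale\<close>)
  qed
  moreover have "S (W x) = W (S x)" if "Vector_Spaces.linear scale scale S" "\<And>y. S (T y) = T (S y)" for S x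
  proof (rule uniq)
    note c = funpow_commute[of S T, OF that(2)]
    show "S (W x) \<in> range (T ^^ m)" using W(1)[of x] c by auto
    show "(T ^^ Suc m) (S (W x)) = (T ^^ Suc m) (W (S x))"
      by (simp only: W(2) c[symmetric])
  qed (rule W)
  moreover have "(T ^^ m) (x - T (W x)) = 0" for x
    using W(2)[of x] by (simp add: diff funpow_swap1)
  ultimately show thesis using that by blast
qed

text \<open>Induction on \<open>p\<close>, multiplying \<open>N\<close> by the Fitting projector
  \<open>1 - V Z_q\<close> of the next operator. The identity 1 - N (1 - V Z_q) = (1 - N) + N V Z_q
  shows that the new coefficient is \<open>N V\<close>. Commutation is carried for all of
  \<open>Z_1, ..., Z_n\<close>, not just the first \<open>p\<close>, so that it is available for the
  operators still to come.\<close>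

lemma joint_fitting_projector:
  fixes Z :: "nat \<Rightarrow> 'b \<Rightarrow> 'b"
  assumes lin: "\<And>l. l \<in> {1..n} \<Longrightarrow> Vector_Spaces.linear scale scale (Z l)"
    and comm: "\<And>k l x. k \<in> {1..n} \<Longrightarrow> l \<in> {1..n} \<Longrightarrow> Z k (Z l x) = Z l (Z k x)"
    and "p \<le> n"
  shows "\<exists>W N. (\<forall>j\<in>{1..p}. Vector_Spaces.linear scale scale (W j)) \<and> Vector_Spaces.linear scale scale N \<and>
    (\<forall>l\<in>{1..n}. \<forall>x. Z l (N x) = N (Z l x)) \<and>
    (\<forall>j\<in>{1..p}. \<forall>l\<in>{1..n}. \<forall>x. Z l (W j x) = W j (Z l x)) \<and>
    (\<forall>x. (\<Sum>j=1..p. W j (Z j x)) = x - N x) \<and>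
    (\<forall>j\<in>{1..p}. \<exists>m. \<forall>x. (Z j ^^ m) (N x) = 0)"
  using \<open>p \<le> n\<close>
proof (induction p)
  case 0
  have "Vector_Spaces.linear scale scale (\<lambda>x. x)" by (simp add: Vector_Spaces.linear_iff vector_space_axioms)
  \<comment> \<open>The empty product of projectors is the identity; the family \<open>W\<close> has
    no index to be constrained at.\<close>
  then show ?case by (intro exI[of _ undefined] exI[of _ "\<lambda>x. x"]) simp
next
  case (Suc p)
  define q where "q = Suc p"
  have q: "q \<in> {1..n}" using Suc.prems by (simp add: q_def)
  obtain W N where IH: "\<forall>j\<in>{1..p}. Vector_Spaces.linear scale scale (W j)"
    "Vector_Spaces.linear scale scale N"
    "\<forall>l\<in>{1..n}. \<forall>x. Z l (N x) = N (Z l x)"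
    "\<forall>j\<in>{1..p}. \<forall>l\<in>{1..n}. \<forall>x. Z l (W j x) = W j (Z l x)"
    "\<forall>x. (\<Sum>j=1..p. W j (Z j x)) = x - N x"
    "\<forall>j\<in>{1..p}. \<exists>m. \<forall>x. (Z j ^^ m) (N x) = 0"
    using Suc.IH[OF Suc_leD[OF Suc.prems]] by (elim exE conjE) (rule that)
  obtain V m where V: "Vector_Spaces.linear scale scale V"
    "\<And>S x. Vector_Spaces.linear scale scale S \<Longrightarrow> (\<And>y. S (Z q y) = Z q (S y)) \<Longrightarrow> S (V x) = V (S x)"
    "\<And>x. (Z q ^^ m) (x - Z q (V x)) = 0"
    using fitting_inverse[OF lin[OF q]] by blast
  have ZV: "Z l (V x) = V (Z l x)" if "l \<in> {1..n}" for l x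
    by (rule V(2)[OF lin[OF that] comm[OF that q]])
  define W' where "W' j = (if j = q then (\<lambda>x. N (V x)) else W j)" for j
  define N' where "N' x = N (x - V (Z q x))" for x
  note Nd = module_hom.diff[OF IH(2)[unfolded linear_iff_module_hom]]
  have lin': "Vector_Spaces.linear scale scale (W' j)" if "j \<in> {1..q}" for j
  proof (cases "j = q")
    case True
    then show ?thesis using IH(2) V(1) by (simp add: W'_def Vector_Spaces.linear_iff)
  next
    case False
    then have "j \<in> {1..p}" using that by (auto simp: q_def)
    then show ?thesis using IH(1) False by (simp add: W'_def)
  qed
  have linN': "Vector_Spaces.linear scale scale N'"
    unfolding Vector_Spaces.linear_iff
  proof (intro conjI allI vector_space_axioms)
    note lins = IH(2) V(1) lin[OF q]
    show "N' (x + y) = N' x + N' y" for x y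
      unfolding N'_def Nd using lins[unfolded Vector_Spaces.linear_iff] by (simp only: add_diff_add)
    show "N' (scale c x) = scale c (N' x)" for c x
      unfolding N'_def Nd using lins[unfolded Vector_Spaces.linear_iff]
      by (simp only: scale_right_diff_distrib)
  qed
  have ZN': "Z l (N' x) = N' (Z l x)" if "l \<in> {1..n}" for l x
    using module_hom.diff[OF lin[OF that, unfolded linear_iff_module_hom]]
    by (simp only: N'_def IH(3)[rule_format, OF that] ZV[OF that] comm[OF that q])
  have ZW': "Z l (W' j x) = W' j (Z l x)" if "j \<in> {1..q}" "l \<in> {1..n}" for j l x
  proof (cases "j = q")
    case True
    then show ?thesis
      by (simp only: W'_def IH(3)[rule_format, OF that(2)] ZV[OF that(2)] if_True refl)
  next
    case False
    then have "j \<in> {1..p}" using that by (auto simp: q_def)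
    then show ?thesis using IH(4)[rule_format, OF _ that(2)] False by (simp only: W'_def if_False)
  qed
  have sum': "(\<Sum>j=1..q. W' j (Z j x)) = x - N' x" for x
  proof -
    have "(\<Sum>j=1..q. W' j (Z j x)) = (\<Sum>j=1..p. W' j (Z j x)) + W' q (Z q x)"
      by (simp add: q_def)
    also have "(\<Sum>j=1..p. W' j (Z j x)) = (\<Sum>j=1..p. W j (Z j x))"
      by (rule sum.cong) (auto simp: W'_def q_def)
    also have "\<dots> = x - N x" using IH(5) by blast
    finally show ?thesis unfolding N'_def Nd by (simp only: W'_def if_True refl) simp
  qed
  \<comment> \<open>For \<open>j = q\<close>, \<open>N\<close> moves out past the powers of
    \<open>Z q\<close>, leaving the defect that they annihilate. For earlier \<open>j\<close>,
    values of \<open>N'\<close> are values of \<open>N\<close>.\<close>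
  have nil': "\<exists>m. \<forall>x. (Z j ^^ m) (N' x) = 0" if "j \<in> {1..q}" for j
  proof (cases "j = q")
    case True
    have "(Z q ^^ m) (N' x) = 0" for x
    proof -
      have "(Z q ^^ m) (N' x) = N ((Z q ^^ m) (x - Z q (V x)))"
        unfolding N'_def ZV[OF q] by (rule funpow_commute[symmetric])
          (rule IH(3)[rule_format, OF q, symmetric])
      also have "\<dots> = 0" using module_hom.zero[OF IH(2)[unfolded linear_iff_module_hom]] V(3) by simp
      finally show ?thesis .
    qed
    then show ?thesis using True by blast
  next
    case False
    then have "j \<in> {1..p}" using that by (auto simp: q_def)
    then obtain m where "\<forall>x. (Z j ^^ m) (N x) = 0" using IH(6) by blast
    then show ?thesis unfolding N'_def by blast
  qed
  show ?case unfolding q_def[symmetric]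
    by (intro exI[of _ W'] exI[of _ N'] conjI ballI allI lin' linN' ZN' ZW' sum' nil')
qed

end

text \<open>For \<open>q = 1, ..., p\<close> in turn, the current vector is replaced by its last
  iterate under \<open>Z q\<close> outside \<open>F\<close>. Earlier conditions survive because the
  operators commute and preserve \<open>F\<close>. For a subspace \<open>F\<close> this is a joint
  null vector in the quotient; the last conjunct keeps the induction going.\<close>

lemma joint_eigenvector_modulo:
  fixes Z :: "nat \<Rightarrow> 'a \<Rightarrow> 'a"
  assumes inv: "\<And>l x. l \<in> {1..n} \<Longrightarrow> x \<in> F \<Longrightarrow> Z l x \<in> F"
    and comm: "\<And>k l x. k \<in> {1..n} \<Longrightarrow> l \<in> {1..n} \<Longrightarrow> Z k (Z l x) = Z l (Z k x)"
    and "x \<notin> F" "\<And>j. j \<in> {1..n} \<Longrightarrow> \<exists>m. (Z j ^^ m) x \<in> F"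
    and "p \<le> n"
  shows "\<exists>y. y \<notin> F \<and> (\<forall>j\<in>{1..p}. Z j y \<in> F) \<and> (\<forall>j\<in>{1..n}. \<exists>m. (Z j ^^ m) y \<in> F)"
  using \<open>p \<le> n\<close>
proof (induction p)
  case 0
  show ?case by (rule exI[of _ x]) (use assms(3,4) in auto)
next
  case (Suc p)
  define q where "q = Suc p"
  have q: "q \<in> {1..n}" using Suc.prems by (simp add: q_def)
  obtain y where y: "y \<notin> F" "\<And>j. j \<in> {1..p} \<Longrightarrow> Z j y \<in> F"
    "\<And>j. j \<in> {1..n} \<Longrightarrow> \<exists>m. (Z j ^^ m) y \<in> F"
    using Suc.IH[OF Suc_leD[OF Suc.prems]] by blast
  have pow: "(Z l ^^ m) x \<in> F" if "l \<in> {1..n}" "x \<in> F" for l m x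
    by (induction m) (use that inv in auto)
  \<comment> \<open>The least exponent is positive since \<open>y\<close> lies outside
    \<open>F\<close>; one power less gives the new vector.\<close>
  define m where "m = (LEAST m. (Z q ^^ m) y \<in> F)"
  have m: "(Z q ^^ m) y \<in> F" unfolding m_def using y(3)[OF q] by (rule LeastI_ex)
  then obtain r where r: "m = Suc r" using y(1) by (cases m) auto
  define z where "z = (Z q ^^ r) y"
  have "z \<notin> F" unfolding z_def
    using not_less_Least[of r "\<lambda>m. (Z q ^^ m) y \<in> F"] r unfolding m_def[symmetric] by simp
  moreover have "Z j z \<in> F" if "j \<in> {1..q}" for j
  proof (cases "j = q")
    case True
    then show ?thesis using m by (simp add: z_def r)
  next
    case False
    then have j: "j \<in> {1..p}" "j \<in> {1..n}" using that q by (auto simp: q_def)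
    have "Z j z = (Z q ^^ r) (Z j y)"
      unfolding z_def by (rule funpow_commute) (rule comm[OF j(2) q])
    then show ?thesis using pow[OF q y(2)[OF j(1)]] by simp
  qed
  moreover have "\<exists>m. (Z j ^^ m) z \<in> F" if j: "j \<in> {1..n}" for j
  proof -
    obtain m where m: "(Z j ^^ m) y \<in> F" using y(3)[OF j] by blast
    have "(Z j ^^ m) z = (Z q ^^ r) ((Z j ^^ m) y)"
      unfolding z_def by (intro funpow_commute funpow_commute[symmetric] comm j q)
    then show ?thesis using pow[OF q m] by metis
  qed
  ultimately show ?case unfolding q_def[symmetric] by blast
qed

section \<open>The Koszul homotopy\<close>

text \<open>For \<open>k\<close> in \<open>J\<close> this is the sign in \<eta>_k \<eta>_(J - k) =
  +- \<eta>_J. It does not depend on whether \<open>k\<close> itself is in \<open>J\<close>, so it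
  also serves for the contraction by \<eta>_k.\<close>

definition koszul_sign :: "nat \<Rightarrow> nat set \<Rightarrow> complex" where
  "koszul_sign k J = (- 1) ^ card {i \<in> J. i < k}"

lemma koszul_sign_square: "koszul_sign k J * koszul_sign k J = 1"
  by (simp add: koszul_sign_def flip: power_mult_distrib)

lemma koszul_sign_remove_self: "koszul_sign k (J - {k}) = koszul_sign k J"
  unfolding koszul_sign_def by (rule arg_cong[where f = "\<lambda>A. (- 1) ^ card A"]) auto

lemma koszul_sign_insert_self: "koszul_sign k (insert k J) = koszul_sign k J"
  unfolding koszul_sign_def by (rule arg_cong[where f = "\<lambda>A. (- 1) ^ card A"]) auto

lemma koszul_sign_insert:
  assumes "finite J" "j \<notin> J"
  shows "koszul_sign k (insert j J) = (if j < k then - 1 else 1) * koszul_sign k J"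
proof -
  have "{i \<in> insert j J. i < k} = (if j < k then insert j {i \<in> J. i < k} else {i \<in> J. i < k})"
    by auto
  then show ?thesis using assms by (simp add: koszul_sign_def)
qed

text \<open>Multiplication by \<eta>_k anticommutes with contraction by \<eta>_j for distinct
  indices: exactly one of \<open>j < k\<close> and \<open>k < j\<close> holds, so just one of the
  two signs flips.\<close>

lemma koszul_sign_exchange:
  assumes "finite J" "k \<in> J" "j \<notin> J"
  shows "koszul_sign k J * koszul_sign j (J - {k})
    = - (koszul_sign j J * koszul_sign k (insert j J))"
proof -
  have "koszul_sign j J = (if k < j then - 1 else 1) * koszul_sign j (J - {k})"
    using koszul_sign_insert[of "J - {k}" k j] assms by (simp add: insert_absorb)
  moreover have "koszul_sign k (insert j J) = (if j < k then - 1 else 1) * koszul_sign k J"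
    using assms by (simp add: koszul_sign_insert)
  moreover have "j \<noteq> k" using assms by auto
  ultimately show ?thesis by (auto simp: not_less)
qed

section \<open>The differential in coordinates, and contraction as a homotopy\<close>

context
  fixes scale :: "complex \<Rightarrow> 'a::ab_group_add \<Rightarrow> 'a"
  assumes vector_space: "vector_space scale"
begin

interpretation vector_space scale by (fact vector_space)

text \<open>Multiplication by \<eta>_k reaches \<eta>_J only from the monomial of
  \<open>J - {k}\<close> with \<open>k\<close> in \<open>J\<close>, so one term per \<open>k\<close>
  survives.\<close>

lemma koszul_diff_eq:
  assumes Z: "\<And>k. k \<in> {1..n} \<Longrightarrow> Vector_Spaces.linear scale scale (Z k)"
    and C: "C \<in> tensor_grassmann n V"
  shows "koszul_diff scale n Z C J
    = (if J \<subseteq> {1..n} then \<Sum>k\<in>J. scale (koszul_sign k J) (Z k (C (J - {k}))) else 0)"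
proof -
  have op: "tensor_op scale n (Z k) (grassmann_mult (gen k)) C J
      = (if J \<subseteq> {1..n} \<and> k \<in> J then scale (koszul_sign k J) (Z k (C (J - {k}))) else 0)"
    if k: "k \<in> {1..n}" for k
  proof (cases "finite J")
    case True
    have "tensor_op scale n (Z k) (grassmann_mult (gen k)) C J
        = (\<Sum>I\<in>Pow {1..n}. if I = J - {k} then
            (if k \<in> J then scale (koszul_sign k J) (Z k (C (J - {k}))) else 0) else 0)"
      unfolding tensor_op_def
      by (rule sum.cong) (auto simp: grassmann_mult_gen_left[OF True] koszul_sign_def monomial_def)
    also have "\<dots> = (if J - {k} \<subseteq> {1..n} then
        (if k \<in> J then scale (koszul_sign k J) (Z k (C (J - {k}))) else 0) else 0)"
      by (subst sum.delta) auto
    also have "\<dots> = (if J \<subseteq> {1..n} \<and> k \<in> J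
        then scale (koszul_sign k J) (Z k (C (J - {k}))) else 0)"
      using k by auto
    finally show ?thesis .
  next
    case False
    \<comment> \<open>For infinite \<open>J\<close> the product is a sum over the infinite set
      \<open>Pow J\<close>, hence 0 by convention.\<close>
    then have "\<not> J \<subseteq> {1..n}" using finite_subset by blast
    then show ?thesis using False by (simp add: tensor_op_def grassmann_mult_def)
  qed
  have "koszul_diff scale n Z C J = (\<Sum>k\<in>{1..n}. if J \<subseteq> {1..n} \<and> k \<in> J
      then scale (koszul_sign k J) (Z k (C (J - {k}))) else 0)"
    unfolding koszul_diff_def by (rule sum.cong) (simp_all add: op)
  also have "\<dots> = (if J \<subseteq> {1..n} then \<Sum>k\<in>J. scale (koszul_sign k J) (Z k (C (J - {k}))) else 0)"
    by (auto simp: sum.inter_restrict[symmetric] Int_absorb1)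
  finally show ?thesis .
qed

text \<open>A Cartan formula. \<open>B\<close> is the contraction of \<open>C\<close> by the sum of
  all W_j d/d\<eta>_j, whose anticommutator with the differential is the sum of all
  \<open>W_j Z_j\<close>. On a cocycle only the differential of the contraction remains.\<close>

lemma koszul_homotopy:
  fixes W Z :: "nat \<Rightarrow> 'a \<Rightarrow> 'a"
  assumes Z: "\<And>k. k \<in> {1..n} \<Longrightarrow> Vector_Spaces.linear scale scale (Z k)"
    and W: "\<And>k. k \<in> {1..n} \<Longrightarrow> Vector_Spaces.linear scale scale (W k)"
    and comm: "\<And>j k x. j \<in> {1..n} \<Longrightarrow> k \<in> {1..n} \<Longrightarrow> Z k (W j x) = W j (Z k x)"
    and C: "cocycle scale n Z UNIV C"
  defines "B \<equiv> \<lambda>J. if J \<subseteq> {1..n}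
      then \<Sum>j\<in>{1..n} - J. scale (koszul_sign j J) (W j (C (insert j J))) else 0"
  shows "koszul_diff scale n Z B
    = (\<lambda>J. if J \<subseteq> {1..n} then \<Sum>j=1..n. W j (Z j (C J)) else 0)"
proof
  fix J
  have C': "C \<in> tensor_grassmann n UNIV" and KC: "\<And>J. koszul_diff scale n Z C J = 0"
    using C by (simp_all add: cocycle_def)
  have B: "B \<in> tensor_grassmann n UNIV" by (simp add: tensor_grassmann_def B_def)
  note lin = linear_iff_module_hom
  note Zs = module_hom.sum[OF Z[unfolded lin]] module_hom.scale[OF Z[unfolded lin]]
  note Ws = module_hom.sum[OF W[unfolded lin]] module_hom.scale[OF W[unfolded lin]]
  show "koszul_diff scale n Z B J
      = (if J \<subseteq> {1..n} then \<Sum>j=1..n. W j (Z j (C J)) else 0)"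
  proof (cases "J \<subseteq> {1..n}")
    case J: True
    then have fin: "finite J" using finite_subset by blast
    \<comment> \<open>The contribution of contracting by \<eta>_j and then multiplying by
      \<eta>_k.\<close>
    define g where "g k j = scale (koszul_sign k J * koszul_sign j (J - {k}))
        (Z k (W j (C (insert j (J - {k})))))" for k j
    \<comment> \<open>After removing \<open>k\<close>, the contraction index is either
      \<open>k\<close> itself, which gives the diagonal term, or lies outside
      \<open>J\<close>.\<close>
    have 1: "scale (koszul_sign k J) (Z k (B (J - {k})))
        = W k (Z k (C J)) + (\<Sum>j\<in>{1..n} - J. g k j)" if k: "k \<in> J" for k
    proof -
      have k': "k \<in> {1..n}" using k J by auto
      have eq: "{1..n} - (J - {k}) = insert k ({1..n} - J)" using k' by auto
      have "scale (koszul_sign k J) (Z k (B (J - {k}))) = (\<Sum>j\<in>insert k ({1..n} - J). g k j)"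
        unfolding eq[symmetric] using J
        by (auto simp add: B_def Zs[OF k'] scale_sum_right g_def simp del: Diff_iff)
      also have "\<dots> = g k k + (\<Sum>j\<in>{1..n} - J. g k j)"
        using k by (subst sum.insert) auto
      also have "g k k = W k (Z k (C J))"
        using k comm[OF k' k'] by (simp add: g_def koszul_sign_remove_self koszul_sign_square insert_absorb)
      finally show ?thesis .
    qed
    \<comment> \<open>The cocycle equation at \<open>insert j J\<close> expresses
      \<open>Z j (C J)\<close> by the terms with \<open>k\<close> in \<open>J\<close>. Applying
      \<open>W j\<close> and exchanging signs turns these into the off-diagonal
      \<open>g k j\<close>.\<close>
    have 2: "(\<Sum>k\<in>J. g k j) = W j (Z j (C J))" if j: "j \<in> {1..n} - J" for j
    proof -
      have j': "j \<in> {1..n}" "j \<notin> J" using j by auto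
      have "koszul_diff scale n Z C (insert j J)
          = (\<Sum>k\<in>insert j J. scale (koszul_sign k (insert j J)) (Z k (C (insert j J - {k}))))"
        using J j by (subst koszul_diff_eq[OF Z C']) auto
      also have "\<dots> = scale (koszul_sign j J) (Z j (C J))
          + (\<Sum>k\<in>J. scale (koszul_sign k (insert j J)) (Z k (C (insert j J - {k}))))"
        using fin j' by (subst sum.insert) (simp_all add: koszul_sign_insert_self)
      finally have 0: "scale (koszul_sign j J) (Z j (C J))
          = - (\<Sum>k\<in>J. scale (koszul_sign k (insert j J)) (Z k (C (insert j J - {k}))))"
        using KC by (simp add: eq_neg_iff_add_eq_0)
      have "g k j = - scale (koszul_sign j J)
          (W j (scale (koszul_sign k (insert j J)) (Z k (C (insert j J - {k})))))"
        if k: "k \<in> J" for k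
      proof -
        have k': "k \<in> {1..n}" "insert j (J - {k}) = insert j J - {k}" using J j k by auto
        show ?thesis
          using koszul_sign_exchange[OF fin k j'(2)]
          by (simp add: g_def comm[OF j'(1) k'(1)] Ws[OF j'(1)] k'(2) scale_minus_left)
      qed
      then have "(\<Sum>k\<in>J. g k j) = (\<Sum>k\<in>J. - scale (koszul_sign j J)
          (W j (scale (koszul_sign k (insert j J)) (Z k (C (insert j J - {k}))))))"
        by (rule sum.cong[OF refl])
      also have "\<dots> = scale (koszul_sign j J) (W j (scale (koszul_sign j J) (Z j (C J))))"
        unfolding 0 by (simp add: Ws(1)[OF j'(1)] sum_negf scale_sum_right
            module_hom.neg[OF W[OF j'(1), unfolded lin]])
      also have "\<dots> = W j (Z j (C J))"
        by (simp add: Ws(2)[OF j'(1)] koszul_sign_square)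
      finally show ?thesis .
    qed
    have "koszul_diff scale n Z B J = (\<Sum>k\<in>J. scale (koszul_sign k J) (Z k (B (J - {k}))))"
      using J by (subst koszul_diff_eq[OF Z B]) auto
    also have "\<dots> = (\<Sum>k\<in>J. W k (Z k (C J)) + (\<Sum>j\<in>{1..n} - J. g k j))"
      by (rule sum.cong[OF refl 1])
    also have "\<dots> = (\<Sum>k\<in>J. W k (Z k (C J))) + (\<Sum>j\<in>{1..n} - J. \<Sum>k\<in>J. g k j)"
      by (simp add: sum.distrib sum.swap[of g])
    also have "(\<Sum>j\<in>{1..n} - J. \<Sum>k\<in>J. g k j) = (\<Sum>j\<in>{1..n} - J. W j (Z j (C J)))"
      by (rule sum.cong) (simp_all add: 2)
    \<comment> \<open>Indices in \<open>J\<close> came from the diagonal, those outside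
      \<open>J\<close> from the cocycle equation; together they exhaust
      \<open>{1..n}\<close>.\<close>
    also have "(\<Sum>k\<in>J. W k (Z k (C J))) + \<dots> = (\<Sum>j=1..n. W j (Z j (C J)))"
      using sum.subset_diff[OF J, of "\<lambda>j. W j (Z j (C J))"] by (simp add: add.commute)
    finally show ?thesis using J by simp
  next
    case False
    show ?thesis by (subst koszul_diff_eq[OF Z B]) (use False in auto)
  qed
qed

text \<open>Applied to the joint projector, this chain map property makes \<open>N C\<close> a
  cocycle.\<close>

lemma koszul_diff_commuting_map:
  assumes Z: "\<And>k. k \<in> {1..n} \<Longrightarrow> Vector_Spaces.linear scale scale (Z k)"
    and N: "Vector_Spaces.linear scale scale N"
    and comm: "\<And>k x. k \<in> {1..n} \<Longrightarrow> Z k (N x) = N (Z k x)"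
    and C: "C \<in> tensor_grassmann n UNIV"
  shows "koszul_diff scale n Z (\<lambda>J. N (C J)) = (\<lambda>J. N (koszul_diff scale n Z C J))"
proof
  fix J
  note N' = module_hom.zero[OF N[unfolded linear_iff_module_hom]]
    module_hom.sum[OF N[unfolded linear_iff_module_hom]]
    module_hom.scale[OF N[unfolded linear_iff_module_hom]]
  have C': "(\<lambda>J. N (C J)) \<in> tensor_grassmann n UNIV"
    using C by (simp add: tensor_grassmann_def N')
  show "koszul_diff scale n Z (\<lambda>J. N (C J)) J = N (koszul_diff scale n Z C J)"
    by (subst (1 2) koszul_diff_eq[OF Z, where V = UNIV])
      (auto simp: C C' N' comm subset_iff intro!: sum.cong)
qed

end

section \<open>Splittings and the passage to the first summand\<close>

lemma proj_along_eqI: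
  assumes "vector_space scale" "splitting scale V W" "v \<in> V" "x - v \<in> W"
  shows "proj_along V W x = v"
proof -
  interpret vector_space scale by fact
  note p = proj_along[OF assms(1,2), of x]
  have sub: "subspace V" "subspace W" and VW: "V \<inter> W = {0}"
    using assms(2) by (auto simp: splitting_def)
  have "proj_along V W x - v \<in> V" by (rule subspace_diff[OF sub(1) p(1) assms(3)])
  moreover have "(x - v) - (x - proj_along V W x) \<in> W"
    by (rule subspace_diff[OF sub(2) assms(4) p(2)])
  ultimately have "proj_along V W x - v \<in> V \<inter> W" by simp
  then show ?thesis using VW by simp
qed

lemma splitting_commute:
  assumes "splitting scale V W"
  shows "splitting scale W V"
proof -
  have "{w + v |w v. w \<in> W \<and> v \<in> V} = {v + w |v w. v \<in> V \<and> w \<in> W}"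
    by (auto intro: add.commute)
  then show ?thesis using assms unfolding splitting_def by (simp add: Int_commute)
qed

theorem proposition9:
  fixes scale :: "complex \<Rightarrow> 'a::ab_group_add \<Rightarrow> 'a" (infixr "*s" 75)
    and Basis :: "'a set"
    and n :: nat
    and X :: "nat \<Rightarrow> 'a \<Rightarrow> 'a"
    and lam :: "nat \<Rightarrow> complex"
    and E1 E2 :: "'a set"
    and C :: "nat set \<Rightarrow> 'a"
  assumes "finite_dimensional_vector_space scale Basis"
    and "\<And>l. l \<in> {1..n} \<Longrightarrow> Vector_Spaces.linear scale scale (X l)"
    and "\<And>k l. k \<in> {1..n} \<Longrightarrow> l \<in> {1..n} \<Longrightarrow> X k \<circ> X l = X l \<circ> X k"
    and "splitting scale E1 E2"
    and "\<And>l x. l \<in> {1..n} \<Longrightarrow> x \<in> E1 \<Longrightarrow> proj_along E2 E1 (X l x) = 0"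
    and "lam \<notin> joint_spectrum scale n E2 (\<lambda>l x. proj_along E2 E1 (X l x))"
    and "cocycle scale n (\<lambda>l x. X l x - lam l *s x) UNIV C"
  shows "\<exists>C1. C1 \<in> tensor_grassmann n E1 \<and>
    cocycle scale n (\<lambda>l x. X l x - lam l *s x) UNIV C1 \<and>
    cohomologous scale n (\<lambda>l x. X l x - lam l *s x) UNIV C C1"
proof -
  interpret finite_dimensional_vector_space scale Basis by fact
  define Z where "Z = (\<lambda>l x. X l x - lam l *s x)"
  note vs = vector_space_axioms
  note split = splitting_commute[OF assms(4)]
  have sub: "subspace E1" using assms(4) by (simp add: splitting_def)
  have Xadd: "X l (x + y) = X l x + X l y" and Xscale: "X l (c *s x) = c *s X l x"
    if "l \<in> {1..n}" for l x y c
    using assms(2)[OF that] by (simp_all add: Vector_Spaces.linear_iff)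
  have Xdiff: "X l (x - y) = X l x - X l y" if "l \<in> {1..n}" for l x y
    using assms(2)[OF that] by (simp add: module_hom.diff linear_iff_module_hom)
  have Xcomm: "X k (X l x) = X l (X k x)" if "k \<in> {1..n}" "l \<in> {1..n}" for k l x
    using fun_cong[OF assms(3)[OF that]] by simp
  have Zlin: "Vector_Spaces.linear scale scale (Z l)" if "l \<in> {1..n}" for l
    unfolding Vector_Spaces.linear_iff Z_def using that
    by (simp add: Xadd Xscale vs scale_right_distrib scale_right_diff_distrib scale_left_commute)
  have Zcomm: "Z k (Z l x) = Z l (Z k x)" if "k \<in> {1..n}" "l \<in> {1..n}" for k l x
    unfolding Z_def using that
    by (simp add: Xdiff Xscale Xcomm scale_right_diff_distrib scale_left_commute algebra_simps)
  have XE1: "X l x \<in> E1" if "l \<in> {1..n}" "x \<in> E1" for l x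
    using proj_along(2)[OF vs split, of "X l x"] assms(5)[OF that] by simp
  have ZE1: "Z l x \<in> E1" if "l \<in> {1..n}" "x \<in> E1" for l x
    unfolding Z_def by (intro subspace_diff subspace_scale sub XE1 that)
  obtain W N where WN: "\<forall>j\<in>{1..n}. Vector_Spaces.linear scale scale (W j)"
    "Vector_Spaces.linear scale scale N"
    "\<forall>l\<in>{1..n}. \<forall>x. Z l (N x) = N (Z l x)"
    "\<forall>j\<in>{1..n}. \<forall>l\<in>{1..n}. \<forall>x. Z l (W j x) = W j (Z l x)"
    "\<forall>x. (\<Sum>j=1..n. W j (Z j x)) = x - N x"
    "\<forall>j\<in>{1..n}. \<exists>m. \<forall>x. (Z j ^^ m) (N x) = 0"
    by (rule exE[OF joint_fitting_projector[of n Z n, OF _ _ order_refl]],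
        erule Zlin, erule (1) Zcomm, elim exE conjE, rule that)
  note Wlin = WN(1)[rule_format] and Nlin = WN(2) and ZN = WN(3)[rule_format]
    and ZW = WN(4)[rule_format] and sumW = WN(5)[rule_format] and nil = WN(6)[rule_format]
  have NE1: "N x \<in> E1" for x
  proof (rule ccontr)
    assume "N x \<notin> E1"
    moreover have "\<exists>m. (Z j ^^ m) (N x) \<in> E1" if "j \<in> {1..n}" for j
      using nil[OF that] subspace_0[OF sub] by metis
    ultimately obtain y where y: "y \<notin> E1" "\<And>j. j \<in> {1..n} \<Longrightarrow> Z j y \<in> E1"
      using joint_eigenvector_modulo[of n E1 Z "N x" n, OF ZE1 Zcomm] by (metis order_refl)
    \<comment> \<open>The \<open>E2\<close> component of \<open>y\<close> represents the same class
      modulo \<open>E1\<close>. Thus each \<open>Z l v\<close> lies in \<open>E1\<close>, which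
      makes \<open>v\<close> a joint eigenvector of the compressed operators.\<close>
    define v where "v = proj_along E2 E1 y"
    have v: "v \<in> E2" "y - v \<in> E1" unfolding v_def by (rule proj_along[OF vs split])+
    have "proj_along E2 E1 (X l v) = lam l *s v" if l: "l \<in> {1..n}" for l
    proof (rule proj_along_eqI[OF vs split])
      show "lam l *s v \<in> E2" using split v(1) by (simp add: splitting_def subspace_scale)
      have "X l v - lam l *s v = Z l y - Z l (y - v)"
        by (simp add: Z_def Xdiff[OF l] scale_right_diff_distrib)
      then show "X l v - lam l *s v \<in> E1"
        using subspace_diff[OF sub y(2)[OF l] ZE1[OF l v(2)]] by simp
    qed
    moreover have "v \<noteq> 0" using v(2) y(1) by auto
    ultimately show False using assms(6) v(1) unfolding joint_spectrum_def by blast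
  qed
  have cocycle: "cocycle scale n Z UNIV C" using assms(7) by (simp add: Z_def)
  then have C: "C \<in> tensor_grassmann n UNIV" and KC: "koszul_diff scale n Z C = (\<lambda>J. 0)"
    by (simp_all add: cocycle_def)
  have N0: "N 0 = 0" using Nlin by (simp add: module_hom.zero linear_iff_module_hom)
  define C1 where "C1 = (\<lambda>J. N (C J))"
  have C0: "C J = 0" if "\<not> J \<subseteq> {1..n}" for J using C that by (simp add: tensor_grassmann_def)
  have C1: "C1 \<in> tensor_grassmann n E1"
    using C0 NE1 by (simp add: C1_def tensor_grassmann_def N0)
  moreover have "cocycle scale n Z UNIV C1"
    using C1 koszul_diff_commuting_map[OF vs Zlin Nlin ZN C]
    by (simp add: cocycle_def C1_def KC N0) (simp add: tensor_grassmann_def)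
  \<comment> \<open>\<open>bexI\<close> leaves the primitive open; rewriting with
    \<open>koszul_homotopy\<close> fixes it as the contraction of \<open>C\<close> by
    \<open>W\<close>. Its differential is \<open>C - N C\<close> by \<open>sumW\<close>.\<close>
  moreover have "cohomologous scale n Z UNIV C C1"
    unfolding cohomologous_def
    by (rule bexI, subst koszul_homotopy[OF vs, of n Z W C, OF Zlin Wlin ZW cocycle], unfold sumW)
      (auto simp: C1_def C0 N0 tensor_grassmann_def)
  ultimately show ?thesis unfolding Z_def by blast
qed

end
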